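(* Let $q\in[1,\infty)$. Under the type $q$-Wasserstein ambiguity set, ALSO-X# is better than the CVaR approximation, i.e., $v_q^{A\#}\le v_q^{\mathrm{CVaR}}$.
   Context: Data. $\mathcal X\subseteq\mathbb{R}^n$, $c\in\mathbb{R}^n$, $\varepsilon\in(0,1)$, $\theta\ge0$, $[I]=\{1,\dots,I\}$, $\|\cdot\|$ a norm on $\mathbb{R}^m$ with dual $\|\cdot\|_*$, $(y)_+=\max\{y,0\}$. For $i\in[I]$, $a_i(x)\in\mathbb{R}^m$ and $b_i(x)\in\mathbb{R}$ are affine in $x\in\mathbb{R}^n$. $\mathbb{P}_\zeta$ is the reference distribution of a random vector $\tilde\zeta$ in $\mathbb{R}^m$, assumed sub-Gaussian: $\mathbb{P}_\zeta\{\|\tilde\zeta\|\ge\tau\}\le C_1\exp(-C_2\tau^2)$ for some $C_1,C_2>0$. The type $q$-Wasserstein ambiguity set $\mathcal P_q$ is the set of probability distributions $\mathbb{P}$ on the support set $\Xi=\mathbb{R}^m$ with $W_q(\mathbb{P},\mathbb{P}_\zeta)\le\theta$, where $W_q(\mathbb{P}_1,\mathbb{P}_2)=\inf_{\mathbb{Q}}\big[\int\|\xi^1-\xi^2\|^q\,\mathbb{Q}(d\xi^1,d\xi^2)\big]^{1/q}$ over couplings $\mathbb{Q}$ of $\mathbb{P}_1,\mathbb{P}_2$. Let $$Z_q=\Big\{x\in\mathbb{R}^n:\inf_{\mathbb{P}\in\mathcal P_q}\mathbb{P}\{a_i(x)^\top\tilde\xi\le b_i(x),\ \forall i\in[I]\}\ge1-\varepsilon\Big\}.$$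 The DRCCP is $\min\{c^\top x:x\in\mathcal X\cap Z_q\}$. For $q>1$, $P_{q,i}(x,\lambda)=\|a_i(x)\|_*^{\frac q{q-1}}\lambda^{-\frac1{q-1}}q^{-\frac q{q-1}}(q-1)$ (for $\lambda=0$: $0$ if $a_i(x)=0$ and $+\infty$ otherwise); for $q=1$, $P_{1,i}(x,\lambda)=0$ if $\|a_i(x)\|_*\le\lambda$ and $+\infty$ otherwise. Put $$L_q(x,\lambda,\beta)=\varepsilon\beta+\lambda\theta^q+\mathbb{E}_{\mathbb{P}_\zeta}\Big[\max_{i\in[I]}\big(a_i(x)^\top\tilde\zeta-b_i(x)+P_{q,i}(x,\lambda)-\beta\big)_+\Big].$$ CVaR approximation: $v_q^{\mathrm{CVaR}}$ is the minimum (infimum) of all $t$ for which there is $(x^*,\lambda^*,\beta^* )\in\arg\min\{L_q(x,\lambda,\beta):x\in\mathcal X,\ c^\top x\le t,\ \lambda\ge0,\ \beta\le0\}$ with $L_q(x^*,\lambda^*,\beta^* )\le0$. ALSO-X#: $v_q^{A\#}$ is the minimum (infimum) of all $t$ for which there is $(x^*,\lambda^*,\beta^* )\in\arg\min\{L_q(x,\lambda,\beta):x\in\mathcal X,\ c^\top x\le t,\ \lambda\ge0,\ \beta\le0\}$ with $x^*\in Z_q$. An infimum over the empty set is $+\infty$. *)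

theory Defs
  imports "HOL-Probability.Probability"
begin

definition is_norm :: "('a::real_vector \<Rightarrow> real) \<Rightarrow> bool" where
  "is_norm N \<longleftrightarrow>
     (\<forall>y. 0 \<le> N y) \<and> (\<forall>y. N y = 0 \<longleftrightarrow> y = 0) \<and>
     (\<forall>r y. N (r *\<^sub>R y) = \<bar>r\<bar> * N y) \<and> (\<forall>y z. N (y + z) \<le> N y + N z)"

definition dual_norm :: "(real^'m \<Rightarrow> real) \<Rightarrow> real^'m \<Rightarrow> real" where
  "dual_norm N v = (SUP y\<in>{y. N y \<le> 1}. v \<bullet> y)"

definition is_affine_map :: "('a::real_vector \<Rightarrow> 'b::real_vector) \<Rightarrow> bool" where
  "is_affine_map f \<longleftrightarrow> (\<exists>g k. linear g \<and> (\<forall>x. f x = g x + k))"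

definition sub_gaussian :: "(real^'m \<Rightarrow> real) \<Rightarrow> (real^'m) measure \<Rightarrow> bool" where
  "sub_gaussian N P \<longleftrightarrow>
     (\<exists>C1>0. \<exists>C2>0. \<forall>\<tau>\<ge>0. measure P {z. N z \<ge> \<tau>} \<le> C1 * exp (- C2 * \<tau>\<^sup>2))"

definition borel_prob :: "(real^'m) measure \<Rightarrow> bool" where
  "borel_prob P \<longleftrightarrow> prob_space P \<and> sets P = sets borel"

definition couplings ::
  "(real^'m) measure \<Rightarrow> (real^'m) measure \<Rightarrow> ((real^'m) \<times> (real^'m)) measure set" where
  "couplings P1 P2 =
     {Q. prob_space Q \<and> sets Q = sets (borel \<Otimes>\<^sub>M borel) \<and>
         distr Q borel fst = P1 \<and> distr Q borel snd = P2}"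

(* u ^ p for p > 0, with infinity ^ p = infinity *)
definition ennreal_rpow :: "ennreal \<Rightarrow> real \<Rightarrow> ennreal" where
  "ennreal_rpow u p = (if u = \<infinity> then \<infinity> else ennreal (enn2real u powr p))"

definition wasserstein ::
  "(real^'m \<Rightarrow> real) \<Rightarrow> real \<Rightarrow> (real^'m) measure \<Rightarrow> (real^'m) measure \<Rightarrow> ennreal" where
  "wasserstein N q P1 P2 =
     (INF Q\<in>couplings P1 P2.
        ennreal_rpow (\<integral>\<^sup>+ (y, z). ennreal (N (y - z) powr q) \<partial>Q) (1 / q))"

definition ambiguity_set ::
  "(real^'m \<Rightarrow> real) \<Rightarrow> real \<Rightarrow> real \<Rightarrow> (real^'m) measure \<Rightarrow> (real^'m) measure set" where
  "ambiguity_set N q \<theta> P\<zeta> = {P. borel_prob P \<and> wasserstein N q P P\<zeta> \<le> ennreal \<theta>}"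

definition Z_set ::
  "(real^'m \<Rightarrow> real) \<Rightarrow> real \<Rightarrow> real \<Rightarrow> (real^'m) measure \<Rightarrow> real \<Rightarrow> nat \<Rightarrow>
   (nat \<Rightarrow> real^'n \<Rightarrow> real^'m) \<Rightarrow> (nat \<Rightarrow> real^'n \<Rightarrow> real) \<Rightarrow> (real^'n) set" where
  "Z_set N q \<theta> P\<zeta> \<epsilon> I a b =
     {x. (INF P\<in>ambiguity_set N q \<theta> P\<zeta>.
            measure P {\<xi>. \<forall>i\<in>{1..I}. a i x \<bullet> \<xi> \<le> b i x}) \<ge> 1 - \<epsilon>}"

(* the term P_{q,i}(x, l), as a function of v = a_i(x); only meaningful for q >= 1, l >= 0 *)
definition penalty :: "(real^'m \<Rightarrow> real) \<Rightarrow> real \<Rightarrow> real^'m \<Rightarrow> real \<Rightarrow> ereal" where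
  "penalty N q v l =
     (if q = 1 then (if dual_norm N v \<le> l then 0 else \<infinity>)
      else if l = 0 then (if v = 0 then 0 else \<infinity>)
      else ereal (dual_norm N v powr (q / (q - 1)) * l powr (- 1 / (q - 1))
                  * q powr (- q / (q - 1)) * (q - 1)))"

(* The integrand is nonnegative and may be infinite, so the expectation is a
   nonnegative integral and the objective takes values in (-infinity, infinity]. *)
definition L_obj ::
  "(real^'m \<Rightarrow> real) \<Rightarrow> real \<Rightarrow> real \<Rightarrow> (real^'m) measure \<Rightarrow> real \<Rightarrow> nat \<Rightarrow>
   (nat \<Rightarrow> real^'n \<Rightarrow> real^'m) \<Rightarrow> (nat \<Rightarrow> real^'n \<Rightarrow> real) \<Rightarrow>
   real^'n \<Rightarrow> real \<Rightarrow> real \<Rightarrow> ereal" where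
  "L_obj N q \<theta> P\<zeta> \<epsilon> I a b x l \<beta> =
     ereal (\<epsilon> * \<beta> + l * \<theta> powr q) +
     enn2ereal (\<integral>\<^sup>+ \<zeta>. e2ennreal
       (MAX i\<in>{1..I}. max 0 (ereal (a i x \<bullet> \<zeta> - b i x) + penalty N q (a i x) l - ereal \<beta>)) \<partial>P\<zeta>)"

definition is_L_argmin ::
  "(real^'m \<Rightarrow> real) \<Rightarrow> real \<Rightarrow> real \<Rightarrow> (real^'m) measure \<Rightarrow> real \<Rightarrow> nat \<Rightarrow>
   (nat \<Rightarrow> real^'n \<Rightarrow> real^'m) \<Rightarrow> (nat \<Rightarrow> real^'n \<Rightarrow> real) \<Rightarrow> (real^'n) set \<Rightarrow> real^'n \<Rightarrow>
   real \<Rightarrow> real^'n \<Rightarrow> real \<Rightarrow> real \<Rightarrow> bool" where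
  "is_L_argmin N q \<theta> P\<zeta> \<epsilon> I a b X c t x l \<beta> \<longleftrightarrow>
     is_arg_min (\<lambda>(x, l, \<beta>). L_obj N q \<theta> P\<zeta> \<epsilon> I a b x l \<beta>)
                (\<lambda>(x, l, \<beta>). x \<in> X \<and> c \<bullet> x \<le> t \<and> l \<ge> 0 \<and> \<beta> \<le> 0) (x, l, \<beta>)"

definition v_CVaR ::
  "(real^'m \<Rightarrow> real) \<Rightarrow> real \<Rightarrow> real \<Rightarrow> (real^'m) measure \<Rightarrow> real \<Rightarrow> nat \<Rightarrow>
   (nat \<Rightarrow> real^'n \<Rightarrow> real^'m) \<Rightarrow> (nat \<Rightarrow> real^'n \<Rightarrow> real) \<Rightarrow> (real^'n) set \<Rightarrow> real^'n \<Rightarrow> ereal" where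
  "v_CVaR N q \<theta> P\<zeta> \<epsilon> I a b X c =
     Inf {ereal t | t. \<exists>x l \<beta>. is_L_argmin N q \<theta> P\<zeta> \<epsilon> I a b X c t x l \<beta> \<and>
                               L_obj N q \<theta> P\<zeta> \<epsilon> I a b x l \<beta> \<le> 0}"

definition v_ALSOX_sharp ::
  "(real^'m \<Rightarrow> real) \<Rightarrow> real \<Rightarrow> real \<Rightarrow> (real^'m) measure \<Rightarrow> real \<Rightarrow> nat \<Rightarrow>
   (nat \<Rightarrow> real^'n \<Rightarrow> real^'m) \<Rightarrow> (nat \<Rightarrow> real^'n \<Rightarrow> real) \<Rightarrow> (real^'n) set \<Rightarrow> real^'n \<Rightarrow> ereal" where
  "v_ALSOX_sharp N q \<theta> P\<zeta> \<epsilon> I a b X c =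
     Inf {ereal t | t. \<exists>x l \<beta>. is_L_argmin N q \<theta> P\<zeta> \<epsilon> I a b X c t x l \<beta> \<and>
                               x \<in> Z_set N q \<theta> P\<zeta> \<epsilon> I a b}"

end

theory Submission
  imports Defs
begin

text \<open>
  Let the loss at \<open>\<xi>\<close> be \<open>f \<xi> = max\<^sub>i (a\<^sub>i(x) \<bullet> \<xi> - b\<^sub>i(x) - \<beta>)\<^sub>+\<close>. The two optimal values are infima
  over sets of levels \<open>t\<close> that differ only in the test applied to a minimiser of \<open>L\<^sub>q\<close>, so it suffices
  that \<open>L\<^sub>q(x, \<lambda>, \<beta>) \<le> 0\<close> with \<open>\<lambda> \<ge> 0\<close> and \<open>\<beta> \<le> 0\<close> forces \<open>x \<in> Z\<^sub>q\<close>
  (\<open>nonpositive_L_obj_imp_Z_set\<close>). This is the easy half of Wasserstein duality followed by Markov's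
  inequality.

  The penalty is the conjugate of the transport cost: \<open>v \<bullet> y \<le> P\<^sub>q(v, \<lambda>) + \<lambda> N(y)\<^sup>q\<close>, which is the
  dual norm inequality combined with Young's inequality (\<open>inner_le_penalty\<close>). With \<open>y = \<xi> - \<zeta>\<close> it
  bounds \<open>f \<xi>\<close> by the penalised loss at \<open>\<zeta>\<close> plus \<open>\<lambda> N(\<xi> - \<zeta>)\<^sup>q\<close>. Integrating against couplings whose
  cost is arbitrarily close to \<open>\<theta>\<^sup>q\<close> gives, for every distribution \<open>P\<close> in the ball,
  \<open>E\<^sub>P f \<le> L\<^sub>q(x, \<lambda>, \<beta>) - \<epsilon> \<beta> \<le> - \<epsilon> \<beta>\<close> (\<open>nn_integral_wasserstein_ball_le\<close>,
  \<open>worst_case_expected_excess_le\<close>).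

  Since \<open>f > - \<beta>\<close> wherever some constraint is violated, Markov's inequality bounds the violation
  probability by \<open>\<epsilon>\<close> if \<open>\<beta> < 0\<close>. If \<open>\<beta> = 0\<close> the expectation of \<open>f\<close> vanishes, so violations have
  probability zero (\<open>violation_prob_le\<close>).
\<close>

section \<open>Norms and their duals\<close>

lemma is_norm_zero: "is_norm N \<Longrightarrow> N 0 = 0"
  by (simp add: is_norm_def)

lemma is_norm_continuous:
  fixes N :: "'a::euclidean_space \<Rightarrow> real"
  assumes "is_norm N"
  shows "continuous_on UNIV N"
proof (rule convex_on_continuous)
  show "convex_on UNIV N"
  proof (rule convex_onI)
    fix t :: real and x y :: 'a
    assume "0 < t" "t < 1"
    then show "N ((1 - t) *\<^sub>R x + t *\<^sub>R y) \<le> (1 - t) * N x + t * N y"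
      using assms unfolding is_norm_def
      by (metis abs_of_pos diff_gt_0_iff_gt)
  qed simp
qed simp

text \<open>
  By homogeneity the constant is the reciprocal of the minimum of \<open>N\<close> on the Euclidean unit sphere,
  which is attained by compactness. The bound makes the supremum that defines the dual norm finite;
  without it that supremum would be an arbitrary real number.
\<close>

lemma is_norm_dominates_norm:
  fixes N :: "real^'m \<Rightarrow> real"
  assumes N: "is_norm N"
  obtains C where "C > 0" "\<And>y. norm y \<le> C * N y"
proof -
  have "\<exists>z\<in>sphere 0 1. \<forall>y\<in>sphere (0::real^'m) 1. N z \<le> N y"
    by (rule continuous_attains_inf)
       (use continuous_on_subset[OF is_norm_continuous[OF N]] in auto)
  then obtain z :: "real^'m" where z: "norm z = 1" "\<And>y. norm y = 1 \<Longrightarrow> N z \<le> N y"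
    by auto
  from z(1) have pos: "N z > 0"
    using N unfolding is_norm_def by (metis less_le norm_zero zero_neq_one)
  have "norm y \<le> inverse (N z) * N y" for y
  proof (cases "y = 0")
    case False
    have "N z \<le> N (inverse (norm y) *\<^sub>R y)"
      using False by (intro z(2)) simp
    also have "\<dots> = inverse (norm y) * N y"
      using N by (simp add: is_norm_def)
    finally show ?thesis
      using False pos by (simp add: field_simps)
  qed (use N in \<open>simp add: is_norm_zero\<close>)
  with pos show thesis
    by (intro that[of "inverse (N z)"]) auto
qed

lemma dual_norm_bdd_above:
  fixes N :: "real^'m \<Rightarrow> real"
  assumes "is_norm N"
  shows "bdd_above ((\<lambda>y. v \<bullet> y) ` {y. N y \<le> 1})"
proof -
  obtain C where C: "C > 0" "\<And>y. norm y \<le> C * N y"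
    using is_norm_dominates_norm[OF assms] by blast
  have "v \<bullet> y \<le> norm v * C" if "N y \<le> 1" for y
  proof -
    have "v \<bullet> y \<le> norm v * norm y"
      by (rule norm_cauchy_schwarz)
    also have "norm y \<le> C"
      using C(2)[of y] mult_left_mono[OF that, of C] C(1) by linarith
    finally show ?thesis
      by (simp add: mult_left_mono)
  qed
  then show ?thesis
    by (intro bdd_aboveI2) auto
qed

lemma dual_norm_nonneg:
  assumes "is_norm N"
  shows "0 \<le> dual_norm N v"
  unfolding dual_norm_def
  using cSUP_upper[OF _ dual_norm_bdd_above[OF assms], of 0 v] is_norm_zero[OF assms] by simp

lemma inner_le_dual_norm:
  assumes N: "is_norm N"
  shows "v \<bullet> y \<le> dual_norm N v * N y"
proof (cases "y = 0")
  case False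
  then have pos: "N y > 0"
    using N unfolding is_norm_def by (metis less_le)
  have "v \<bullet> (inverse (N y) *\<^sub>R y) \<le> dual_norm N v"
    unfolding dual_norm_def
    using pos N by (intro cSUP_upper dual_norm_bdd_above) (auto simp: is_norm_def)
  then show ?thesis
    using pos by (simp add: field_simps)
qed (use N in \<open>simp add: is_norm_zero\<close>)

section \<open>The penalty as a conjugate\<close>

text \<open>
  The first summand on the right is the maximum of \<open>D * s - l * s powr q\<close> over \<open>s \<ge> 0\<close>. The inequality
  is Young's for the exponents \<open>q\<close> and \<open>q / (q - 1)\<close>, after rescaling \<open>s\<close> so that its \<open>q\<close>-th power
  receives the coefficient \<open>l\<close>.
\<close>

lemma scaled_Young:
  fixes D s l q :: real
  assumes "1 < q" "0 < l" "0 \<le> D" "0 \<le> s"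
  shows "D * s \<le> D powr (q / (q - 1)) * l powr (- 1 / (q - 1)) * q powr (- q / (q - 1)) * (q - 1)
                 + l * s powr q"
proof -
  define p where "p = q / (q - 1)"
  \<comment> \<open>the factor for which \<open>(k * s) powr q / q = l * s powr q\<close>\<close>
  define k where "k = (l * q) powr (1 / q)"
  have p: "p > 1" "1 / q + 1 / p = 1"
    using assms by (auto simp: p_def field_simps)
  have k: "k > 0"
    using assms by (simp add: k_def)
  have "D * s = (k * s) * (D / k)"
    using k by simp
  also have "\<dots> \<le> (k * s) powr q / q + (D / k) powr p / p"
    using assms p k by (intro Youngs_inequality) auto
  also have "(k * s) powr q / q = l * s powr q"
    using assms by (simp add: k_def powr_mult powr_powr)
  also have "(D / k) powr p / p
      = D powr p * l powr (- 1 / (q - 1)) * q powr (- q / (q - 1)) * (q - 1)"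
  proof -
    have "k powr (- p) = (l * q) powr (- 1 / (q - 1))"
      using assms by (simp add: k_def p_def powr_powr)
    moreover have "(D / k) powr p = D powr p * k powr (- p)"
      using k by (simp add: divide_inverse powr_mult powr_minus inverse_powr)
    ultimately have "(D / k) powr p
        = D powr p * l powr (- 1 / (q - 1)) * q powr (- 1 / (q - 1))"
      by (simp add: powr_mult)
    moreover have "q powr (- q / (q - 1)) = q powr (- 1 / (q - 1)) / q"
    proof -
      have "- q / (q - 1) = - 1 / (q - 1) - 1"
        using assms by (simp add: field_simps)
      then show ?thesis
        using assms by (simp only: powr_diff) simp
    qed
    ultimately show ?thesis
      using assms by (simp add: p_def)
  qed
  finally show ?thesis
    by (simp add: p_def)
qed

text \<open>
  The pointwise form of weak duality. The infinite values of the penalty are exactly the cases in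
  which \<open>v \<bullet> y - l * N y powr q\<close> is unbounded above in \<open>y\<close>.
\<close>

lemma inner_le_penalty:
  assumes N: "is_norm N" and q: "q \<ge> 1" and l: "l \<ge> 0"
  shows "ereal (v \<bullet> y) \<le> penalty N q v l + ereal (l * N y powr q)"
proof -
  have Ny: "N y \<ge> 0"
    using N by (simp add: is_norm_def)
  have *: "v \<bullet> y \<le> dual_norm N v * N y"
    by (rule inner_le_dual_norm[OF N])
  consider "q = 1" | "q > 1" "l = 0" | "q > 1" "l > 0"
    using q l by linarith
  then show ?thesis
  proof cases
    case 1
    have "v \<bullet> y \<le> l * N y" if "dual_norm N v \<le> l"
      using * mult_right_mono[OF that Ny] by linarith
    then show ?thesis
      using 1 Ny by (auto simp: penalty_def)
  next
    case 2
    then show ?thesis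
      by (auto simp: penalty_def)
  next
    case 3
    then show ?thesis
      using * scaled_Young[of q l "dual_norm N v" "N y"] dual_norm_nonneg[OF N, of v] Ny
      by (auto simp: penalty_def)
  qed
qed

section \<open>Transport bounds over the Wasserstein ball\<close>

text \<open>
  The Wasserstein distance is an infimum that no coupling is shown to attain, so each estimate is made
  with a coupling of cost below some \<open>r > \<theta> powr q\<close>, and \<open>r\<close> is then sent to \<open>\<theta> powr q\<close>.
\<close>

lemma ennreal_rpow_less_imp:
  assumes "ennreal_rpow u (1 / q) < ennreal (r powr (1 / q))" "q > 0" "r \<ge> 0"
  shows "u < ennreal r"
proof (rule ccontr)
  assume "\<not> u < ennreal r"
  then have "ennreal r \<le> u" by simp
  then have "ennreal (r powr (1 / q)) \<le> ennreal_rpow u (1 / q)"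
    using assms(2,3)
    by (cases u) (auto simp: ennreal_rpow_def intro!: ennreal_leI powr_mono2)
  with assms(1) show False by simp
qed

lemma wasserstein_ball_near_optimal_coupling:
  assumes "P \<in> ambiguity_set N q \<theta> P\<zeta>" "q > 0" "\<theta> \<ge> 0" "\<theta> powr q < r"
  obtains Q where "Q \<in> couplings P P\<zeta>"
    "(\<integral>\<^sup>+ (y, z). ennreal (N (y - z) powr q) \<partial>Q) < ennreal r"
proof -
  have r: "r > 0"
    using assms(4) by (meson le_less_trans powr_ge_zero)
  have "\<theta> = (\<theta> powr q) powr (1 / q)"
    using assms by (simp add: powr_powr)
  also have "\<dots> < r powr (1 / q)"
    using assms by (intro powr_less_mono2) auto
  finally have "ennreal \<theta> < ennreal (r powr (1 / q))"
    using assms(3) by (simp add: ennreal_less_iff)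
  with assms(1) have "wasserstein N q P P\<zeta> < ennreal (r powr (1 / q))"
    by (auto simp: ambiguity_set_def)
  then obtain Q where "Q \<in> couplings P P\<zeta>"
    "ennreal_rpow (\<integral>\<^sup>+ (y, z). ennreal (N (y - z) powr q) \<partial>Q) (1 / q) < ennreal (r powr (1 / q))"
    unfolding wasserstein_def INF_less_iff by blast
  with that show thesis
    using ennreal_rpow_less_imp r assms(2) by (metis less_imp_le)
qed

lemma nn_integral_coupling_le:
  fixes f g :: "real^'m \<Rightarrow> ennreal"
  assumes N: "is_norm N" and Q: "Q \<in> couplings P R" and l: "l \<ge> 0"
    and [measurable]: "f \<in> borel_measurable borel" "g \<in> borel_measurable borel"
    and le: "\<And>y z. f y \<le> g z + ennreal (l * N (y - z) powr q)"
  shows "(\<integral>\<^sup>+ y. f y \<partial>P) \<le> (\<integral>\<^sup>+ z. g z \<partial>R)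
           + ennreal l * (\<integral>\<^sup>+ (y, z). ennreal (N (y - z) powr q) \<partial>Q)"
proof -
  have [measurable_cong]: "sets Q = sets (borel \<Otimes>\<^sub>M borel)"
    and P: "P = distr Q borel fst" and R: "R = distr Q borel snd"
    using Q by (auto simp: couplings_def)
  have [measurable]: "N \<in> borel_measurable borel"
    by (intro borel_measurable_continuous_onI is_norm_continuous[OF N])
  have "(\<integral>\<^sup>+ y. f y \<partial>P) = (\<integral>\<^sup>+ w. f (fst w) \<partial>Q)"
    unfolding P by (rule nn_integral_distr) measurable
  also have "\<dots> \<le> (\<integral>\<^sup>+ w. g (snd w) + ennreal l * ennreal (N (fst w - snd w) powr q) \<partial>Q)"
    using le l by (intro nn_integral_mono) (simp add: ennreal_mult)
  also have "\<dots> = (\<integral>\<^sup>+ w. g (snd w) \<partial>Q)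
      + ennreal l * (\<integral>\<^sup>+ w. ennreal (N (fst w - snd w) powr q) \<partial>Q)"
    by (subst nn_integral_add, measurable) (simp add: nn_integral_cmult)
  also have "(\<integral>\<^sup>+ w. g (snd w) \<partial>Q) = (\<integral>\<^sup>+ z. g z \<partial>R)"
    unfolding R by (rule nn_integral_distr[symmetric]) measurable
  finally show ?thesis
    by (simp add: case_prod_unfold)
qed

text \<open>
  Weak duality for an arbitrary loss: if \<open>f\<close> exceeds \<open>g\<close> by at most \<open>l\<close> times the transport cost,
  then its expectation exceeds that of \<open>g\<close> by at most \<open>l\<close> times the cost budget of the ball.
\<close>

lemma nn_integral_wasserstein_ball_le:
  fixes f g :: "real^'m \<Rightarrow> ennreal"
  assumes N: "is_norm N" and q: "q > 0" and \<theta>: "\<theta> \<ge> 0" and l: "l \<ge> 0"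
    and P: "P \<in> ambiguity_set N q \<theta> P\<zeta>"
    and meas: "f \<in> borel_measurable borel" "g \<in> borel_measurable borel"
    and le: "\<And>y z. f y \<le> g z + ennreal (l * N (y - z) powr q)"
  shows "(\<integral>\<^sup>+ y. f y \<partial>P) \<le> (\<integral>\<^sup>+ z. g z \<partial>P\<zeta>) + ennreal (l * \<theta> powr q)"
proof (rule ennreal_le_epsilon)
  fix e :: real
  assume e: "e > 0"
  \<comment> \<open>the denominator \<open>l + 1\<close> keeps \<open>l * r\<close> within \<open>e\<close> of \<open>l * \<theta> powr q\<close> and also covers \<open>l = 0\<close>\<close>
  define r where "r = \<theta> powr q + e / (l + 1)"
  have r: "\<theta> powr q < r" and r0: "r \<ge> 0"
    using e l by (auto simp: r_def)
  obtain Q where Q: "Q \<in> couplings P P\<zeta>"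
    and cost: "(\<integral>\<^sup>+ (y, z). ennreal (N (y - z) powr q) \<partial>Q) < ennreal r"
    using wasserstein_ball_near_optimal_coupling[OF P q \<theta> r] by blast
  have "l * r = l * \<theta> powr q + (l / (l + 1)) * e"
    by (simp add: r_def algebra_simps)
  also have "\<dots> \<le> l * \<theta> powr q + e"
    using l e by (simp add: field_simps)
  finally have lr: "l * r \<le> l * \<theta> powr q + e" .
  have "(\<integral>\<^sup>+ y. f y \<partial>P) \<le> (\<integral>\<^sup>+ z. g z \<partial>P\<zeta>)
      + ennreal l * (\<integral>\<^sup>+ (y, z). ennreal (N (y - z) powr q) \<partial>Q)"
    by (rule nn_integral_coupling_le[OF N Q l meas le])
  also have "\<dots> \<le> (\<integral>\<^sup>+ z. g z \<partial>P\<zeta>) + ennreal l * ennreal r"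
    using cost by (intro add_left_mono mult_left_mono) auto
  also have "ennreal l * ennreal r = ennreal (l * r)"
    using l r0 by (simp add: ennreal_mult)
  also have "\<dots> \<le> ennreal (l * \<theta> powr q) + ennreal e"
    using ennreal_leI[OF lr] l e by simp
  finally show "(\<integral>\<^sup>+ y. f y \<partial>P) \<le> (\<integral>\<^sup>+ z. g z \<partial>P\<zeta>) + ennreal (l * \<theta> powr q) + ennreal e"
    by (simp add: add.assoc add_left_mono)
qed

text \<open>
  The coupling concentrated on the diagonal costs nothing. Membership of the reference distribution
  matters because the worst-case probability is a real infimum, which is meaningful only over a
  nonempty set.
\<close>

lemma reference_in_ambiguity_set:
  assumes N: "is_norm N" and q: "q > 0" and P: "borel_prob P\<zeta>"
  shows "P\<zeta> \<in> ambiguity_set N q \<theta> P\<zeta>"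
proof -
  interpret prob_space P\<zeta>
    using P by (simp add: borel_prob_def)
  have [measurable_cong]: "sets P\<zeta> = sets borel"
    using P by (simp add: borel_prob_def)
  have [measurable]: "N \<in> borel_measurable borel"
    by (intro borel_measurable_continuous_onI is_norm_continuous[OF N])
  define Q where "Q = distr P\<zeta> (borel \<Otimes>\<^sub>M borel) (\<lambda>z. (z, z))"
  have "Q \<in> couplings P\<zeta> P\<zeta>"
    by (auto simp: couplings_def Q_def distr_distr comp_def distr_id2 \<open>sets P\<zeta> = sets borel\<close>
        intro!: prob_space_distr)
  moreover have "(\<integral>\<^sup>+ (y, z). ennreal (N (y - z) powr q) \<partial>Q) = 0"
    by (simp add: Q_def nn_integral_distr is_norm_zero[OF N])
  ultimately have "wasserstein N q P\<zeta> P\<zeta> \<le> ennreal_rpow 0 (1 / q)"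
    unfolding wasserstein_def by (metis (lifting) INF_lower)
  also have "\<dots> = 0"
    by (simp add: ennreal_rpow_def)
  finally show ?thesis
    using P by (simp add: ambiguity_set_def)
qed

section \<open>Feasibility from a nonpositive objective\<close>

lemma excess_le_penalized_excess:
  fixes I :: nat
  assumes N: "is_norm N" and q: "q \<ge> 1" and l: "l \<ge> 0" and I: "I \<ge> 1"
  shows "(MAX i\<in>{1..I}. ennreal (a i \<bullet> y - b i - \<beta>))
    \<le> e2ennreal (MAX i\<in>{1..I}. max 0 (ereal (a i \<bullet> z - b i) + penalty N q (a i) l - ereal \<beta>))
       + ennreal (l * N (y - z) powr q)"
    (is "?f \<le> e2ennreal ?G + _")
proof (rule Max.boundedI)
  fix u
  assume "u \<in> (\<lambda>i. ennreal (a i \<bullet> y - b i - \<beta>)) ` {1..I}"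
  then obtain i where i: "i \<in> {1..I}" and u: "u = ennreal (a i \<bullet> y - b i - \<beta>)"
    by blast
  let ?g = "max 0 (ereal (a i \<bullet> z - b i) + penalty N q (a i) l - ereal \<beta>)"
  let ?c = "l * N (y - z) powr q"
  have "ereal (a i \<bullet> (y - z)) \<le> penalty N q (a i) l + ereal ?c"
    by (rule inner_le_penalty[OF N q l])
  then have "ereal (a i \<bullet> y - b i - \<beta>)
      \<le> (ereal (a i \<bullet> z - b i) + penalty N q (a i) l - ereal \<beta>) + ereal ?c"
    by (cases "penalty N q (a i) l") (auto simp: inner_diff_right)
  also have "\<dots> \<le> ?g + ereal ?c"
    by (intro add_right_mono) simp
  finally have "e2ennreal (ereal (a i \<bullet> y - b i - \<beta>)) \<le> e2ennreal (?g + ereal ?c)"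
    by (rule e2ennreal_mono)
  also have "\<dots> = e2ennreal ?g + ennreal ?c"
    using l by (cases ?g) (auto simp flip: ennreal_plus simp: max_def split: if_splits)
  also have "e2ennreal ?g \<le> e2ennreal ?G"
    using i by (intro e2ennreal_mono Max_ge) auto
  finally show "u \<le> e2ennreal ?G + ennreal ?c"
    by (simp add: u add_right_mono)
qed (use I in auto)

lemma worst_case_expected_excess_le:
  assumes N: "is_norm N" and q: "q \<ge> 1" and \<theta>: "\<theta> \<ge> 0" and l: "l \<ge> 0" and I: "I \<ge> 1"
    and P: "P \<in> ambiguity_set N q \<theta> P\<zeta>"
    and L: "L_obj N q \<theta> P\<zeta> \<epsilon> I a b x l \<beta> \<le> 0"
  shows "(\<integral>\<^sup>+ y. (MAX i\<in>{1..I}. ennreal (a i x \<bullet> y - b i x - \<beta>)) \<partial>P) \<le> ennreal (- \<epsilon> * \<beta>)"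
proof -
  define g where "g = (\<lambda>z. e2ennreal
    (MAX i\<in>{1..I}. max 0 (ereal (a i x \<bullet> z - b i x) + penalty N q (a i x) l - ereal \<beta>)))"
  define G where "G = (\<integral>\<^sup>+ z. g z \<partial>P\<zeta>)"
  have le0: "ereal (\<epsilon> * \<beta> + l * \<theta> powr q) + enn2ereal G \<le> 0"
    using L by (simp add: L_obj_def g_def G_def)
  have meas: "(\<lambda>y. MAX i\<in>{1..I}. ennreal (a i x \<bullet> y - b i x - \<beta>)) \<in> borel_measurable borel"
    "g \<in> borel_measurable borel"
    unfolding g_def by measurable
  have "(\<integral>\<^sup>+ y. (MAX i\<in>{1..I}. ennreal (a i x \<bullet> y - b i x - \<beta>)) \<partial>P) \<le> G + ennreal (l * \<theta> powr q)"
    unfolding G_def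
  proof (rule nn_integral_wasserstein_ball_le[OF N _ \<theta> l P meas])
    fix y z
    show "(MAX i\<in>{1..I}. ennreal (a i x \<bullet> y - b i x - \<beta>)) \<le> g z + ennreal (l * N (y - z) powr q)"
      unfolding g_def by (rule excess_le_penalized_excess[OF N q l I])
  qed (use q in simp)
  also have "\<dots> \<le> ennreal (- \<epsilon> * \<beta>)"
  proof (cases G)
    case (real s)
    then have "\<epsilon> * \<beta> + l * \<theta> powr q + s \<le> 0"
      using le0 by simp
    then show ?thesis
      using real l by (simp flip: ennreal_plus add: ennreal_leI)
  qed (use le0 in simp)
  finally show ?thesis .
qed

text \<open>
  Markov's inequality at the threshold \<open>- \<beta>\<close> divides by \<open>- \<beta>\<close>, which fails for \<open>\<beta> = 0\<close>. There the
  hypothesis says that \<open>f\<close> has expectation zero, hence vanishes almost everywhere, while it is positive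
  on \<open>V\<close>.
\<close>

lemma violation_prob_le:
  assumes P: "prob_space P" and sets_P: "sets P = sets borel" and "0 < \<epsilon>" and \<beta>: "\<beta> \<le> 0"
    and f: "f \<in> borel_measurable borel"
    and V: "V \<in> sets borel" "\<And>y. y \<in> V \<Longrightarrow> ennreal (- \<beta>) < f y"
    and int: "(\<integral>\<^sup>+ y. f y \<partial>P) \<le> ennreal (- \<epsilon> * \<beta>)"
  shows "measure P V \<le> \<epsilon>"
proof -
  interpret prob_space P by (rule P)
  note [measurable_cong] = sets_P
  note [measurable] = f V(1)
  show ?thesis
  proof (cases "\<beta> = 0")
    case True
    then have "(\<integral>\<^sup>+ y. f y \<partial>P) = 0"
      using int by simp
    then have "AE y in P. f y = 0"
      by (subst (asm) nn_integral_0_iff_AE) auto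
    then have "AE y in P. y \<notin> V"
      using V(2) by (auto elim!: eventually_mono dest!: V(2))
    then have "prob V = 0"
      by (subst prob_eq_0) auto
    with \<open>0 < \<epsilon>\<close> show ?thesis by simp
  next
    case False
    with \<beta> have neg: "\<beta> < 0" by simp
    have "ennreal (- \<beta>) * emeasure P V = (\<integral>\<^sup>+ y. ennreal (- \<beta>) * indicator V y \<partial>P)"
      by (simp add: nn_integral_cmult_indicator)
    also have "\<dots> \<le> (\<integral>\<^sup>+ y. f y \<partial>P)"
      using V(2) by (intro nn_integral_mono) (auto simp: indicator_def less_imp_le)
    also note int
    finally have "ennreal (- \<beta> * prob V) \<le> ennreal (- \<beta> * \<epsilon>)"
      using neg by (simp add: emeasure_eq_measure ennreal_mult'[of "- \<beta>" "prob V", simplified] mult.commute)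
    then show ?thesis
      using neg \<open>0 < \<epsilon>\<close> by (simp add: ennreal_le_iff mult_nonpos_nonneg)
  qed
qed

lemma nonpositive_L_obj_imp_Z_set:
  assumes N: "is_norm N" and q: "q \<ge> 1" and \<epsilon>: "0 < \<epsilon>" and \<theta>: "\<theta> \<ge> 0" and I: "I \<ge> 1"
    and ref: "borel_prob P\<zeta>" and l: "l \<ge> 0" and \<beta>: "\<beta> \<le> 0"
    and L: "L_obj N q \<theta> P\<zeta> \<epsilon> I a b x l \<beta> \<le> 0"
  shows "x \<in> Z_set N q \<theta> P\<zeta> \<epsilon> I a b"
proof -
  have "1 - \<epsilon> \<le> measure P {\<xi>. \<forall>i\<in>{1..I}. a i x \<bullet> \<xi> \<le> b i x}"
    if P: "P \<in> ambiguity_set N q \<theta> P\<zeta>" for P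
  proof -
    have P_prob: "prob_space P" and sets_P: "sets P = sets borel"
      using P by (auto simp: ambiguity_set_def borel_prob_def)
    interpret prob_space P by (rule P_prob)
    define S where "S = {\<xi>. \<forall>i\<in>{1..I}. a i x \<bullet> \<xi> \<le> b i x}"
    have S: "S \<in> sets borel"
      unfolding S_def by measurable
    have "measure P (- S) \<le> \<epsilon>"
    proof (rule violation_prob_le[OF P_prob sets_P \<epsilon> \<beta>])
      show "(\<lambda>y. MAX i\<in>{1..I}. ennreal (a i x \<bullet> y - b i x - \<beta>)) \<in> borel_measurable borel"
        by measurable
      show "- S \<in> sets borel"
        using S by auto
      show "(\<integral>\<^sup>+ y. (MAX i\<in>{1..I}. ennreal (a i x \<bullet> y - b i x - \<beta>)) \<partial>P) \<le> ennreal (- \<epsilon> * \<beta>)"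
        by (rule worst_case_expected_excess_le[OF N q \<theta> l I P L])
    next
      fix y
      assume "y \<in> - S"
      then obtain i where i: "i \<in> {1..I}" "b i x < a i x \<bullet> y"
        by (auto simp: S_def not_le)
      then have "ennreal (- \<beta>) < ennreal (a i x \<bullet> y - b i x - \<beta>)"
        using \<beta> by (intro ennreal_lessI) auto
      also have "\<dots> \<le> (MAX i\<in>{1..I}. ennreal (a i x \<bullet> y - b i x - \<beta>))"
        using i by (intro Max_ge) auto
      finally show "ennreal (- \<beta>) < (MAX i\<in>{1..I}. ennreal (a i x \<bullet> y - b i x - \<beta>))" .
    qed
    moreover have "measure P (- S) = 1 - measure P S"
      using S prob_compl[of S] sets_eq_imp_space_eq[OF sets_P] sets_P
      by (simp add: Compl_eq_Diff_UNIV)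
    ultimately show ?thesis
      by (simp add: S_def)
  qed
  moreover have "ambiguity_set N q \<theta> P\<zeta> \<noteq> {}"
    using reference_in_ambiguity_set[OF N _ ref, of q \<theta>] q by auto
  ultimately show ?thesis
    unfolding Z_set_def by (auto intro!: cINF_greatest)
qed

theorem proposition1:
  fixes X :: "(real^'n) set" and c :: "real^'n"
    and N :: "real^'m \<Rightarrow> real"
    and P\<zeta> :: "(real^'m) measure"
    and I :: nat
    and a :: "nat \<Rightarrow> real^'n \<Rightarrow> real^'m"
    and b :: "nat \<Rightarrow> real^'n \<Rightarrow> real"
    and q \<epsilon> \<theta> :: real
  assumes "q \<ge> 1" and "0 < \<epsilon>" and "\<epsilon> < 1" and "\<theta> \<ge> 0" and "I \<ge> 1"
    and "is_norm N"
    and "\<And>i. i \<in> {1..I} \<Longrightarrow> is_affine_map (a i)"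
    and "\<And>i. i \<in> {1..I} \<Longrightarrow> is_affine_map (b i)"
    and "borel_prob P\<zeta>" and "sub_gaussian N P\<zeta>"
  shows "v_ALSOX_sharp N q \<theta> P\<zeta> \<epsilon> I a b X c \<le> v_CVaR N q \<theta> P\<zeta> \<epsilon> I a b X c"
proof -
  have "x \<in> Z_set N q \<theta> P\<zeta> \<epsilon> I a b"
    if "is_L_argmin N q \<theta> P\<zeta> \<epsilon> I a b X c t x l \<beta>" "L_obj N q \<theta> P\<zeta> \<epsilon> I a b x l \<beta> \<le> 0"
    for t x l \<beta>
    using that assms
    by (intro nonpositive_L_obj_imp_Z_set[where l = l and \<beta> = \<beta>])
       (auto simp: is_L_argmin_def is_arg_min_def)
  then show ?thesis
    unfolding v_ALSOX_sharp_def v_CVaR_def by (intro Inf_superset_mono) blast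
qed

end
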